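(* Let $(R_i)_{i\in S}$ be a family of nonzero commutative rings indexed by a set $S$, let $R=\prod_{i\in S}R_i$, and for $k\in S$ let $\pi_k:R\to R_k$ be the projection map. Then the tame max-regular ideals of $R$ are precisely the ideals of the form $\pi_k^{-1}(M)$ where $k\in S$ and $M$ is a max-regular ideal of $R_k$.
   Context: All rings are commutative with identity. A regular ideal of a ring $A$ is an ideal generated by a set of idempotents of $A$. A max-regular ideal of $A$ is a maximal element (with respect to inclusion) of the set of proper regular ideals of $A$. A tame prime of $R=\prod_{i\in S}R_i$ is a prime ideal of $R$ of the form $\pi_k^{-1}(\mathfrak p)$ for some $k\in S$ and some prime ideal $\mathfrak p$ of $R_k$. A tame max-regular ideal of $R=\prod_{i\in S}R_i$ is a max-regular ideal $M$ of $R$ such that $V(M)=\{\mathfrak p\in\operatorname{Spec}(R): M\subseteq\mathfrak p\}$ is contained in the set of tame primes of $R$. *)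

theory Defs
  imports "HOL-Algebra.Algebra"
begin

text \<open>Direct product of a family of rings, extending \<^const>\<open>product_group\<close> (which only needs
  the multiplicative structure). Elements are extensional functions: \<open>undefined\<close> outside \<open>S\<close>.\<close>

definition product_ring :: "'i set \<Rightarrow> ('i \<Rightarrow> ('a, 'm) ring_scheme) \<Rightarrow> ('i \<Rightarrow> 'a) ring"
  where "product_ring S R =
    monoid.extend (product_group S R)
      (ring.fields (\<lambda>i\<in>S. \<zero>\<^bsub>R i\<^esub>) (\<lambda>x y. \<lambda>i\<in>S. x i \<oplus>\<^bsub>R i\<^esub> y i))"

lemma product_ring_simps [simp]:
  "carrier (product_ring S R) = (\<Pi>\<^sub>E i\<in>S. carrier (R i))"
  "(\<otimes>\<^bsub>product_ring S R\<^esub>) = (\<lambda>x y. \<lambda>i\<in>S. x i \<otimes>\<^bsub>R i\<^esub> y i)"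
  "\<one>\<^bsub>product_ring S R\<^esub> = (\<lambda>i\<in>S. \<one>\<^bsub>R i\<^esub>)"
  "(\<oplus>\<^bsub>product_ring S R\<^esub>) = (\<lambda>x y. \<lambda>i\<in>S. x i \<oplus>\<^bsub>R i\<^esub> y i)"
  "\<zero>\<^bsub>product_ring S R\<^esub> = (\<lambda>i\<in>S. \<zero>\<^bsub>R i\<^esub>)"
  by (simp_all add: product_ring_def product_group_def monoid.defs ring.defs)

lemma product_ring_cring:
  assumes "\<And>i. i \<in> S \<Longrightarrow> cring (R i)"
  shows "cring (product_ring S R)"
proof (intro cringI abelian_groupI comm_monoidI, goal_cases)
  case (5 x)
  then show ?case
    using assms by (auto simp: PiE_iff extensional_def fun_eq_iff cring.cring_simprules(8))
next
  case (6 x)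
  let ?y = "\<lambda>i\<in>S. \<ominus>\<^bsub>R i\<^esub> x i"
  have "ring (R i)" if "i \<in> S" for i
    using assms[OF that] by (rule cring.axioms)
  then have "?y \<in> carrier (product_ring S R)" "?y \<oplus>\<^bsub>product_ring S R\<^esub> x = \<zero>\<^bsub>product_ring S R\<^esub>"
    using 6 by (auto simp: PiE_iff ring.ring_simprules intro!: restrict_ext)
  then show ?case by blast
next
  case (10 x)
  have "monoid (R i)" if "i \<in> S" for i
    using assms[OF that] by (intro ring.is_monoid cring.axioms)
  with 10 show ?case
    by (auto simp: PiE_iff extensional_def fun_eq_iff monoid.l_one)
qed (use assms in \<open>auto simp: PiE_iff cring.cring_simprules intro!: restrict_ext\<close>)

definition proj :: "'i \<Rightarrow> ('i \<Rightarrow> 'a) \<Rightarrow> 'a"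
  where "proj k x = x k"

lemma proj_ring_hom:
  assumes "k \<in> S"
  shows "proj k \<in> ring_hom (product_ring S R) (R k)"
  using assms by (auto simp: proj_def ring_hom_def)

definition proj_preimage ::
    "'i set \<Rightarrow> ('i \<Rightarrow> ('a, 'm) ring_scheme) \<Rightarrow> 'i \<Rightarrow> 'a set \<Rightarrow> ('i \<Rightarrow> 'a) set"
  where "proj_preimage S R k I = {x \<in> carrier (product_ring S R). proj k x \<in> I}"

definition idempotents :: "('a, 'm) ring_scheme \<Rightarrow> 'a set"
  where "idempotents A = {e \<in> carrier A. e \<otimes>\<^bsub>A\<^esub> e = e}"

definition regular_ideal :: "'a set \<Rightarrow> ('a, 'm) ring_scheme \<Rightarrow> bool"
  where "regular_ideal I A \<longleftrightarrow> (\<exists>E. E \<subseteq> idempotents A \<and> I = Idl\<^bsub>A\<^esub> E)"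

definition max_regular_ideal :: "'a set \<Rightarrow> ('a, 'm) ring_scheme \<Rightarrow> bool"
  where "max_regular_ideal M A \<longleftrightarrow>
    regular_ideal M A \<and> M \<noteq> carrier A \<and>
    (\<forall>I. regular_ideal I A \<and> I \<noteq> carrier A \<and> M \<subseteq> I \<longrightarrow> I = M)"

definition Spec :: "('a, 'm) ring_scheme \<Rightarrow> 'a set set"
  where "Spec A = {P. primeideal P A}"

definition vanishing_set :: "('a, 'm) ring_scheme \<Rightarrow> 'a set \<Rightarrow> 'a set set"
  where "vanishing_set A I = {P \<in> Spec A. I \<subseteq> P}"

definition tame_primes :: "'i set \<Rightarrow> ('i \<Rightarrow> ('a, 'm) ring_scheme) \<Rightarrow> ('i \<Rightarrow> 'a) set set"
  where "tame_primes S R =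
    {P \<in> Spec (product_ring S R). \<exists>k\<in>S. \<exists>Q\<in>Spec (R k). P = proj_preimage S R k Q}"

definition tame_max_regular_ideal ::
    "('i \<Rightarrow> 'a) set \<Rightarrow> 'i set \<Rightarrow> ('i \<Rightarrow> ('a, 'm) ring_scheme) \<Rightarrow> bool"
  where "tame_max_regular_ideal M S R \<longleftrightarrow>
    max_regular_ideal M (product_ring S R) \<and>
    vanishing_set (product_ring S R) M \<subseteq> tame_primes S R"

end

(* Let e be the idempotent of the product that is 1 at k and 0 elsewhere. The ideals that contain
   the complementary idempotent 1 - e are exactly the preimages of ideals of R_k, and under this
   correspondence regular, max-regular and prime ideals match up; since 1 - e lies in every such
   preimage, every prime above one is tame. Conversely, a max-regular ideal M contains one of
   e and 1 - e. If M contained e for every k, then no tame prime could lie above M, although M,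
   being proper, is contained in some prime ideal. *)

theory Submission
  imports Defs
begin

section \<open>Ideals and idempotents in a commutative ring\<close>

lemma (in cring) exists_primeideal_superset:
  assumes "ideal I R" "I \<noteq> carrier R"
  obtains P where "primeideal P R" "I \<subseteq> P"
proof -
  have proper: "J \<noteq> carrier R \<longleftrightarrow> \<one> \<notin> J" if "ideal J R" for J
    using ideal.one_imp_carrier[OF that] by auto
  \<comment> \<open>Properness is encoded as the absence of \<open>\<one>\<close>: in this form it
    passes to unions of chains, so Zorn's lemma yields a maximal ideal above \<open>I\<close>, which
    is prime.\<close>
  define \<A> where "\<A> = {J. ideal J R \<and> \<one> \<notin> J \<and> I \<subseteq> J}"
  have "\<A> \<noteq> {}"
    using assms proper by (auto simp: \<A>_def)
  moreover have "\<Union>\<C> \<in> \<A>" if "\<C> \<noteq> {}" "subset.chain \<A> \<C>" for \<C>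
  proof -
    have sub: "\<C> \<subseteq> \<A>"
      using that by (simp add: pred_on.chain_def)
    have "subset.chain {J. ideal J R} \<C>"
      using that by (auto simp: pred_on.chain_def \<A>_def)
    from chain_Union_is_ideal[OF this] that(1) have "ideal (\<Union>\<C>) R"
      by simp
    then show ?thesis
      using sub that(1) by (auto simp: \<A>_def)
  qed
  ultimately obtain P where P: "P \<in> \<A>" "\<And>J. J \<in> \<A> \<Longrightarrow> P \<subseteq> J \<Longrightarrow> J = P"
    using subset_Zorn_nonempty[of \<A>] by blast
  have "maximalideal P R"
  proof (rule maximalidealI)
    show "J = P \<or> J = carrier R" if "ideal J R" "P \<subseteq> J" for J
      using P proper that by (auto simp: \<A>_def)
  qed (use P proper in \<open>auto simp: \<A>_def\<close>)
  then show thesis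
    using P(1) that maximalideal_prime by (auto simp: \<A>_def)
qed

text \<open>This is the colon ideal (I : a). It will serve as a witness of properness: it omits
  \<open>\<one>\<close> as soon as \<open>a\<close> lies outside \<open>I\<close>.\<close>

lemma (in cring) colon_ideal:
  assumes "ideal I R" "a \<in> carrier R"
  shows "ideal {x \<in> carrier R. a \<otimes> x \<in> I} R"
proof -
  interpret I: ideal I R by fact
  show ?thesis
  proof (intro idealI ring_axioms subgroup.intro)
    fix x assume x: "x \<in> {x \<in> carrier R. a \<otimes> x \<in> I}"
    then have "a \<otimes> (\<ominus> x) = \<ominus> (a \<otimes> x)"
      using assms(2) by (simp add: r_minus)
    then show "inv\<^bsub>add_monoid R\<^esub> x \<in> {x \<in> carrier R. a \<otimes> x \<in> I}"
      using x by (simp flip: a_inv_def)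
  next
    fix x y assume x: "x \<in> {x \<in> carrier R. a \<otimes> x \<in> I}" and y: "y \<in> carrier R"
    then have "a \<otimes> (x \<otimes> y) = (a \<otimes> x) \<otimes> y"
      using assms(2) by (simp add: m_assoc)
    then show *: "x \<otimes> y \<in> {x \<in> carrier R. a \<otimes> x \<in> I}"
      using x y by (simp add: I.I_r_closed)
    then show "y \<otimes> x \<in> {x \<in> carrier R. a \<otimes> x \<in> I}"
      using x y by (simp add: m_comm)
  qed (use assms(2) in \<open>auto simp: r_distr\<close>)
qed

text \<open>If some set of idempotents generates \<open>I\<close>, so does the set of all
  idempotents in \<open>I\<close>, since it lies between that set and \<open>I\<close>. Stating this
  as minimality among ideals removes the choice of generators, so that regularity can be transported
  along a correspondence of ideals.\<close>

lemma (in cring) regular_ideal_iff: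
  "regular_ideal I R \<longleftrightarrow>
    ideal I R \<and> (\<forall>J. ideal J R \<and> idempotents R \<inter> I \<subseteq> J \<longrightarrow> I \<subseteq> J)"
proof safe
  assume "regular_ideal I R"
  then obtain E where E: "E \<subseteq> idempotents R" "I = Idl E"
    by (auto simp: regular_ideal_def)
  then have Ec: "E \<subseteq> carrier R"
    by (auto simp: idempotents_def)
  then show "ideal I R"
    using E by (simp add: genideal_ideal)
  fix J x assume J: "ideal J R" "idempotents R \<inter> I \<subseteq> J" "x \<in> I"
  have "E \<subseteq> J"
    using E J genideal_self[OF Ec] by blast
  then show "x \<in> J"
    using genideal_minimal J E by blast
next
  assume I: "ideal I R" and min: "\<forall>J. ideal J R \<and> idempotents R \<inter> I \<subseteq> J \<longrightarrow> I \<subseteq> J"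
  have c: "idempotents R \<inter> I \<subseteq> carrier R"
    by (auto simp: idempotents_def)
  have "I = Idl (idempotents R \<inter> I)"
    using genideal_minimal[OF I, of "idempotents R \<inter> I"] genideal_ideal[OF c] genideal_self[OF c] min
    by blast
  then show "regular_ideal I R"
    unfolding regular_ideal_def by blast
qed

text \<open>Enlarge \<open>M\<close> by the generator \<open>e\<close>. If \<open>f\<close> is not
  in \<open>M\<close>, the colon ideal (M : f) is proper; it contains \<open>M\<close>, and it
  contains \<open>e\<close> because \<open>f \<otimes> e\<close> vanishes. So the enlarged regular
  ideal is still proper, and maximality forces it to equal \<open>M\<close>.\<close>

lemma (in cring) max_regular_ideal_idempotent:
  assumes M: "max_regular_ideal M R"
    and e: "e \<in> idempotents R" and f: "f \<in> carrier R" and ef: "f \<otimes> e = \<zero>"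
  shows "e \<in> M \<or> f \<in> M"
proof (rule disjCI)
  assume "f \<notin> M"
  from M obtain E where E: "E \<subseteq> idempotents R" "M = Idl E"
    by (auto simp: max_regular_ideal_def regular_ideal_def)
  define I where "I = Idl (insert e E)"
  define C where "C = {x \<in> carrier R. f \<otimes> x \<in> M}"
  have c: "insert e E \<subseteq> carrier R"
    using E e by (auto simp: idempotents_def)
  interpret M: ideal M R
    using E c by (simp add: genideal_ideal)
  have EM: "E \<subseteq> M"
    using E c genideal_self[of E] by simp
  have C: "ideal C R"
    unfolding C_def using M.is_ideal f by (rule colon_ideal)
  have "insert e E \<subseteq> C"
    using c f ef EM by (auto simp: C_def M.I_l_closed)
  then have "I \<subseteq> C"
    unfolding I_def using C by (rule genideal_minimal[rotated])
  moreover have "\<one> \<notin> C"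
    using \<open>f \<notin> M\<close> f by (simp add: C_def)
  ultimately have "I \<noteq> carrier R"
    by auto
  moreover have "regular_ideal I R"
    unfolding regular_ideal_def I_def using E e by blast
  moreover have ins: "insert e E \<subseteq> I"
    unfolding I_def using c by (rule genideal_self)
  then have "M \<subseteq> I"
    using E genideal_minimal genideal_ideal[OF c] by (simp add: I_def)
  ultimately have "I = M"
    using M by (simp add: max_regular_ideal_def)
  then show "e \<in> M"
    using ins by blast
qed

(* With k in S, single S R k 1 is the idempotent e of the header and cosingle S R k is 1 - e. *)
definition single :: "'i set \<Rightarrow> ('i \<Rightarrow> ('a, 'm) ring_scheme) \<Rightarrow> 'i \<Rightarrow> 'a \<Rightarrow> 'i \<Rightarrow> 'a"
  where "single S R k a = (\<lambda>i\<in>S. if i = k then a else \<zero>\<^bsub>R i\<^esub>)"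

definition cosingle :: "'i set \<Rightarrow> ('i \<Rightarrow> ('a, 'm) ring_scheme) \<Rightarrow> 'i \<Rightarrow> 'i \<Rightarrow> 'a"
  where "cosingle S R k = (\<lambda>i\<in>S. if i = k then \<zero>\<^bsub>R i\<^esub> else \<one>\<^bsub>R i\<^esub>)"

section \<open>One factor inside the product: coordinate computations\<close>

locale product_ring_factor =
  fixes S :: "'i set" and R :: "'i \<Rightarrow> ('a, 'm) ring_scheme" and k :: 'i
  assumes cring_factor: "i \<in> S \<Longrightarrow> cring (R i)"
    and k_in: "k \<in> S"
begin

sublocale prod: cring "product_ring S R"
  by (rule product_ring_cring) (rule cring_factor)

sublocale factor: cring "R k"
  by (rule cring_factor) (rule k_in)

sublocale proj: ring_hom_ring "product_ring S R" "R k" "proj k"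
  by (intro ring_hom_ringI2 prod.ring_axioms factor.ring_axioms proj_ring_hom k_in)

lemma ring_factor: "i \<in> S \<Longrightarrow> ring (R i)"
  using cring_factor by (rule cring.axioms)

lemma single_closed: "a \<in> carrier (R k) \<Longrightarrow> single S R k a \<in> carrier (product_ring S R)"
  by (auto simp: single_def ring.ring_simprules(2)[OF ring_factor])

lemma cosingle_closed: "cosingle S R k \<in> carrier (product_ring S R)"
  by (auto simp: cosingle_def ring.ring_simprules[OF ring_factor])

lemma proj_single: "proj k (single S R k a) = a"
  using k_in by (simp add: proj_def single_def)

lemma proj_cosingle: "proj k (cosingle S R k) = \<zero>\<^bsub>R k\<^esub>"
  using k_in by (simp add: proj_def cosingle_def)

text \<open>Extension by zero respects sums and products but in general not the identity, so it is
  no ring homomorphism; its algebraic rules are recorded one by one.\<close>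

lemma single_add:
  "single S R k a \<oplus>\<^bsub>product_ring S R\<^esub> single S R k b = single S R k (a \<oplus>\<^bsub>R k\<^esub> b)"
  by (auto simp: single_def ring.ring_simprules[OF ring_factor] intro!: restrict_ext)

lemma single_mult:
  "single S R k a \<otimes>\<^bsub>product_ring S R\<^esub> single S R k b = single S R k (a \<otimes>\<^bsub>R k\<^esub> b)"
  by (auto simp: single_def cring.cring_simprules[OF cring_factor] intro!: restrict_ext)

lemma single_zero: "single S R k \<zero>\<^bsub>R k\<^esub> = \<zero>\<^bsub>product_ring S R\<^esub>"
  by (auto simp: single_def)

lemma single_one_mult:
  assumes "x \<in> carrier (product_ring S R)"
  shows "single S R k \<one>\<^bsub>R k\<^esub> \<otimes>\<^bsub>product_ring S R\<^esub> x = single S R k (proj k x)"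
  using assms
  by (auto simp: single_def proj_def PiE_iff cring.cring_simprules[OF cring_factor] intro!: restrict_ext)

lemma cosingle_mult_single:
  assumes "a \<in> carrier (R k)"
  shows "cosingle S R k \<otimes>\<^bsub>product_ring S R\<^esub> single S R k a = \<zero>\<^bsub>product_ring S R\<^esub>"
  using assms
  by (auto simp: single_def cosingle_def cring.cring_simprules[OF cring_factor] intro!: restrict_ext)

text \<open>The Peirce decomposition of \<open>x\<close> for the two complementary idempotents. In
  an ideal containing \<open>cosingle S R k\<close> the first summand is automatic, so membership of
  \<open>x\<close> depends only on its coordinate at \<open>k\<close>.\<close>

lemma cosingle_decomp:
  assumes "x \<in> carrier (product_ring S R)"
  shows "x = cosingle S R k \<otimes>\<^bsub>product_ring S R\<^esub> x \<oplus>\<^bsub>product_ring S R\<^esub> single S R k (proj k x)"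
  using assms
  by (auto simp: fun_eq_iff single_def cosingle_def proj_def PiE_iff extensional_def
      cring.cring_simprules[OF cring_factor] ring.ring_simprules[OF ring_factor]
      monoid.r_one[OF ring.is_monoid[OF ring_factor]])

lemma idempotent_single:
  "e \<in> idempotents (R k) \<Longrightarrow> single S R k e \<in> idempotents (product_ring S R)"
  unfolding idempotents_def mem_Collect_eq using single_closed single_mult by presburger

lemma idempotent_cosingle: "cosingle S R k \<in> idempotents (product_ring S R)"
  using cosingle_closed
  by (auto simp: idempotents_def cosingle_def cring.cring_simprules[OF cring_factor] intro!: restrict_ext)

text \<open>The coordinate computations end here. With the unfolding rules off, the rest of the
  locale treats the product as an abstract ring, to which general ring lemmas apply.\<close>

declare product_ring_simps [simp del]

lemma idempotent_proj:
  "e \<in> idempotents (product_ring S R) \<Longrightarrow> proj k e \<in> idempotents (R k)"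
  unfolding idempotents_def mem_Collect_eq using proj.hom_closed proj.hom_mult by metis

section \<open>Preimages of ideals of one factor\<close>

lemma ideal_proj_preimage: "ideal J (R k) \<Longrightarrow> ideal (proj_preimage S R k J) (product_ring S R)"
  unfolding proj_preimage_def by (rule proj.ideal_vimage)

lemma single_mem_preimage_iff:
  "a \<in> carrier (R k) \<Longrightarrow> single S R k a \<in> proj_preimage S R k J \<longleftrightarrow> a \<in> J"
  using single_closed by (simp add: proj_preimage_def proj_single)

lemma cosingle_in_preimage: "ideal J (R k) \<Longrightarrow> cosingle S R k \<in> proj_preimage S R k J"
  using cosingle_closed additive_subgroup.zero_closed[OF ideal.axioms(1)]
  by (simp add: proj_preimage_def proj_cosingle)

lemma preimage_carrier: "proj_preimage S R k (carrier (R k)) = carrier (product_ring S R)"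
  using proj.hom_closed by (auto simp: proj_preimage_def)

text \<open>\<open>single S R k\<close> is a section of the projection: each element of
  \<open>J\<close> lifts to the preimage and is recovered from its lift.\<close>

lemma preimage_subset_iff:
  assumes "J \<subseteq> carrier (R k)"
  shows "proj_preimage S R k J \<subseteq> proj_preimage S R k K \<longleftrightarrow> J \<subseteq> K"
proof
  assume sub: "proj_preimage S R k J \<subseteq> proj_preimage S R k K"
  show "J \<subseteq> K"
  proof
    fix a assume "a \<in> J"
    then show "a \<in> K"
      using sub assms single_mem_preimage_iff[of a J] single_mem_preimage_iff[of a K] by blast
  qed
qed (auto simp: proj_preimage_def)

lemma preimage_eq_iff:
  assumes "J \<subseteq> carrier (R k)" "K \<subseteq> carrier (R k)"
  shows "proj_preimage S R k J = proj_preimage S R k K \<longleftrightarrow> J = K"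
  using assms preimage_subset_iff[of J K] preimage_subset_iff[of K J] by blast

lemma ideal_subset: "ideal J (R k) \<Longrightarrow> J \<subseteq> carrier (R k)"
  by (simp add: additive_subgroup.a_subset ideal.axioms(1))

lemma preimage_eq_carrier_iff:
  assumes "ideal J (R k)"
  shows "proj_preimage S R k J = carrier (product_ring S R) \<longleftrightarrow> J = carrier (R k)"
  using preimage_eq_iff[OF ideal_subset[OF assms] order_refl] by (simp only: preimage_carrier)

text \<open>The ideal \<open>J\<close> is the pullback of \<open>I\<close> along extension by zero.
  For one inclusion, multiply an element of \<open>I\<close> by the idempotent at \<open>k\<close>;
  for the other, use \<open>cosingle_decomp\<close>, whose first summand is a multiple of
  \<open>cosingle S R k\<close>.\<close>

lemma ideal_eq_preimage:
  assumes "ideal I (product_ring S R)" "cosingle S R k \<in> I"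
  obtains J where "ideal J (R k)" "I = proj_preimage S R k J"
proof
  interpret I: ideal I "product_ring S R" by fact
  let ?J = "{a \<in> carrier (R k). single S R k a \<in> I}"
  show "ideal ?J (R k)"
  proof (intro idealI factor.ring_axioms subgroup.intro)
    fix x y assume x: "x \<in> ?J" and y: "y \<in> carrier (R k)"
    then have "single S R k x \<otimes>\<^bsub>product_ring S R\<^esub> single S R k y \<in> I"
      by (intro I.I_r_closed single_closed) auto
    then show *: "x \<otimes>\<^bsub>R k\<^esub> y \<in> ?J"
      using x y single_mult by simp
    then show "y \<otimes>\<^bsub>R k\<^esub> x \<in> ?J"
      using x y by (simp add: factor.m_comm)
  next
    fix x assume x: "x \<in> ?J"
    \<comment> \<open>Writing negation as multiplication by minus one reduces it to absorption in
      \<open>I\<close> and \<open>single_mult\<close>.\<close>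
    let ?u = "\<ominus>\<^bsub>R k\<^esub> \<one>\<^bsub>R k\<^esub>"
    have "single S R k x \<otimes>\<^bsub>product_ring S R\<^esub> single S R k ?u \<in> I"
      using x by (intro I.I_r_closed single_closed) auto
    moreover have "x \<otimes>\<^bsub>R k\<^esub> ?u = \<ominus>\<^bsub>R k\<^esub> x"
      using x by (simp add: factor.r_minus)
    ultimately show "inv\<^bsub>add_monoid (R k)\<^esub> x \<in> ?J"
      using x single_mult[of x ?u] by (simp flip: a_inv_def)
  next
    fix x y assume "x \<in> ?J" "y \<in> ?J"
    then show "x \<otimes>\<^bsub>add_monoid (R k)\<^esub> y \<in> ?J"
      using I.a_closed[of "single S R k x" "single S R k y"] single_add[of x y] by simp
  qed (use I.zero_closed single_zero in auto)
  show "I = proj_preimage S R k ?J"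
  proof (intro Set.set_eqI iffI)
    fix x assume "x \<in> I"
    then have x: "x \<in> carrier (product_ring S R)"
      by (rule I.Icarr)
    have "single S R k (proj k x) \<in> I"
      unfolding single_one_mult[symmetric, OF x]
      using \<open>x \<in> I\<close> by (intro I.I_l_closed single_closed) auto
    then show "x \<in> proj_preimage S R k ?J"
      using x proj.hom_closed unfolding proj_preimage_def by blast
  next
    fix x assume "x \<in> proj_preimage S R k ?J"
    then have x: "x \<in> carrier (product_ring S R)" "single S R k (proj k x) \<in> I"
      by (auto simp: proj_preimage_def)
    then show "x \<in> I"
      by (subst cosingle_decomp) (auto intro: I.a_closed I.I_r_closed assms(2))
  qed
qed

text \<open>By \<open>regular_ideal_iff\<close> both sides are minimality conditions. Every ideal
  tested upstairs is itself a preimage, so both conditions range over corresponding ideals.\<close>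

lemma regular_preimage_iff:
  assumes J: "ideal J (R k)"
  shows "regular_ideal (proj_preimage S R k J) (product_ring S R) \<longleftrightarrow> regular_ideal J (R k)"
proof
  assume reg: "regular_ideal (proj_preimage S R k J) (product_ring S R)"
  have "J \<subseteq> K" if K: "ideal K (R k)" "idempotents (R k) \<inter> J \<subseteq> K" for K
  proof -
    have "idempotents (product_ring S R) \<inter> proj_preimage S R k J \<subseteq> proj_preimage S R k K"
      using K(2) idempotent_proj by (auto simp: proj_preimage_def)
    then have "proj_preimage S R k J \<subseteq> proj_preimage S R k K"
      using reg ideal_proj_preimage[OF K(1)] by (simp add: prod.regular_ideal_iff)
    then show ?thesis
      using preimage_subset_iff[OF ideal_subset[OF J]] by simp
  qed
  then show "regular_ideal J (R k)"
    using J by (simp add: factor.regular_ideal_iff)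
next
  assume reg: "regular_ideal J (R k)"
  have "proj_preimage S R k J \<subseteq> I"
    if I: "ideal I (product_ring S R)" "idempotents (product_ring S R) \<inter> proj_preimage S R k J \<subseteq> I" for I
  proof -
    \<comment> \<open>The complementary idempotent is one of the idempotents of the preimage, so
      \<open>I\<close> must contain it.\<close>
    have "cosingle S R k \<in> I"
      using I(2) idempotent_cosingle cosingle_in_preimage[OF J] by blast
    with I(1) obtain K where K: "ideal K (R k)" "I = proj_preimage S R k K"
      by (rule ideal_eq_preimage)
    have "e \<in> K" if e: "e \<in> idempotents (R k) \<inter> J" for e
    proof -
      have "e \<in> carrier (R k)"
        using e by (simp add: idempotents_def)
      then show ?thesis
        using e I(2) K(2) idempotent_single[of e] single_mem_preimage_iff[of e] by blast
    qed
    then have "J \<subseteq> K"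
      using reg K(1) by (auto simp: factor.regular_ideal_iff)
    then show ?thesis
      using K(2) by (auto simp: proj_preimage_def)
  qed
  then show "regular_ideal (proj_preimage S R k J) (product_ring S R)"
    using ideal_proj_preimage[OF J] by (simp add: prod.regular_ideal_iff)
qed

text \<open>Regular ideals above the preimage contain \<open>cosingle S R k\<close>, hence are
  preimages of regular ideals above \<open>J\<close>. The correspondence preserves inclusion and
  properness in both directions, so it preserves maximality.\<close>

lemma max_regular_preimage_iff:
  assumes J: "ideal J (R k)"
  shows "max_regular_ideal (proj_preimage S R k J) (product_ring S R) \<longleftrightarrow> max_regular_ideal J (R k)"
proof
  assume max: "max_regular_ideal (proj_preimage S R k J) (product_ring S R)"
  have "K = J" if K: "regular_ideal K (R k)" "K \<noteq> carrier (R k)" "J \<subseteq> K" for K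
  proof -
    have iK: "ideal K (R k)"
      using K(1) by (simp add: factor.regular_ideal_iff)
    have "proj_preimage S R k K = proj_preimage S R k J"
      using max K regular_preimage_iff[OF iK] preimage_eq_carrier_iff[OF iK]
        preimage_subset_iff[OF ideal_subset[OF J]]
      unfolding max_regular_ideal_def by blast
    then show ?thesis
      using preimage_eq_iff[OF ideal_subset[OF iK] ideal_subset[OF J]] by simp
  qed
  then show "max_regular_ideal J (R k)"
    using max regular_preimage_iff[OF J] preimage_eq_carrier_iff[OF J]
    unfolding max_regular_ideal_def by blast
next
  assume max: "max_regular_ideal J (R k)"
  have "I = proj_preimage S R k J"
    if I: "regular_ideal I (product_ring S R)" "I \<noteq> carrier (product_ring S R)"
      "proj_preimage S R k J \<subseteq> I" for I
  proof -
    have "ideal I (product_ring S R)" "cosingle S R k \<in> I"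
      using I cosingle_in_preimage[OF J] prod.regular_ideal_iff by auto
    then obtain K where K: "ideal K (R k)" "I = proj_preimage S R k K"
      by (rule ideal_eq_preimage)
    then have "K = J"
      using max I regular_preimage_iff[OF K(1)] preimage_eq_carrier_iff[OF K(1)]
        preimage_subset_iff[OF ideal_subset[OF J]]
      unfolding max_regular_ideal_def by blast
    with K show ?thesis by simp
  qed
  then show "max_regular_ideal (proj_preimage S R k J) (product_ring S R)"
    using max regular_preimage_iff[OF J] preimage_eq_carrier_iff[OF J]
    unfolding max_regular_ideal_def by blast
qed

text \<open>Primality is tested on lifts: by \<open>single_mult\<close>, a product in
  \<open>J\<close> lifts to a product in the preimage, and the prime upstairs contains one of the
  lifted factors.\<close>

lemma primeideal_of_preimage:
  assumes J: "ideal J (R k)" and P: "primeideal (proj_preimage S R k J) (product_ring S R)"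
  shows "primeideal J (R k)"
proof (rule primeidealI[OF J factor.is_cring])
  show "carrier (R k) \<noteq> J"
    using preimage_carrier primeideal.I_notcarr[OF P] by blast
next
  fix a b assume ab: "a \<in> carrier (R k)" "b \<in> carrier (R k)" "a \<otimes>\<^bsub>R k\<^esub> b \<in> J"
  then have "single S R k a \<otimes>\<^bsub>product_ring S R\<^esub> single S R k b \<in> proj_preimage S R k J"
    unfolding single_mult using single_mem_preimage_iff[OF factor.m_closed] by blast
  then have "single S R k a \<in> proj_preimage S R k J \<or> single S R k b \<in> proj_preimage S R k J"
    using ab by (intro primeideal.I_prime[OF P] single_closed)
  then show "a \<in> J \<or> b \<in> J"
    using ab single_mem_preimage_iff by blast
qed

text \<open>Any prime above the preimage of an ideal of \<open>R k\<close> contains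
  \<open>cosingle S R k\<close>, so this bounds the vanishing set of such a preimage.\<close>

lemma primeideal_tame:
  assumes P: "primeideal P (product_ring S R)" and "cosingle S R k \<in> P"
  shows "P \<in> tame_primes S R"
proof -
  obtain J where J: "ideal J (R k)" "P = proj_preimage S R k J"
    using primeideal.axioms(1)[OF P] assms(2) by (rule ideal_eq_preimage)
  then have "J \<in> Spec (R k)"
    using P primeideal_of_preimage unfolding Spec_def by blast
  then show ?thesis
    using P J(2) k_in unfolding tame_primes_def Spec_def by blast
qed

lemma tame_max_regular_preimage:
  assumes "max_regular_ideal J (R k)"
  shows "tame_max_regular_ideal (proj_preimage S R k J) S R"
proof -
  have J: "ideal J (R k)"
    using assms by (simp add: max_regular_ideal_def factor.regular_ideal_iff)
  then show ?thesis
    using assms max_regular_preimage_iff[OF J] cosingle_in_preimage[OF J] primeideal_tame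
    unfolding tame_max_regular_ideal_def vanishing_set_def Spec_def by blast
qed

text \<open>The general idempotent lemma, with the idempotent at \<open>k\<close> as
  \<open>e\<close> and its complement as \<open>f\<close>; their product is zero.\<close>

lemma max_regular_dichotomy:
  assumes "max_regular_ideal M (product_ring S R)"
  shows "single S R k \<one>\<^bsub>R k\<^esub> \<in> M \<or> cosingle S R k \<in> M"
  using assms
proof (rule prod.max_regular_ideal_idempotent)
  show "single S R k \<one>\<^bsub>R k\<^esub> \<in> idempotents (product_ring S R)"
    by (rule idempotent_single) (simp add: idempotents_def)
qed (rule cosingle_closed, rule cosingle_mult_single, rule factor.one_closed)

end

section \<open>Locating the factor of a tame max-regular ideal, and the characterization\<close>

lemma tame_max_regular_ideal_obtain_cosingle:
  assumes cring: "\<And>i. i \<in> S \<Longrightarrow> cring (R i)" and M: "tame_max_regular_ideal M S R"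
  obtains k where "k \<in> S" "cosingle S R k \<in> M"
proof -
  interpret prod: cring "product_ring S R"
    using cring by (rule product_ring_cring)
  have max: "max_regular_ideal M (product_ring S R)"
    and tame: "vanishing_set (product_ring S R) M \<subseteq> tame_primes S R"
    using M by (simp_all add: tame_max_regular_ideal_def)
  then have "ideal M (product_ring S R)" "M \<noteq> carrier (product_ring S R)"
    unfolding max_regular_ideal_def prod.regular_ideal_iff by blast+
  \<comment> \<open>A single prime above \<open>M\<close> is enough: tameness presents it as a
    preimage from some factor, and that factor supplies the index \<open>k\<close>.\<close>
  then obtain P where P: "primeideal P (product_ring S R)" "M \<subseteq> P"
    by (rule prod.exists_primeideal_superset)
  then have "P \<in> tame_primes S R"
    using tame unfolding vanishing_set_def Spec_def by blast
  then obtain k Q where k: "k \<in> S" "primeideal Q (R k)" "P = proj_preimage S R k Q"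
    unfolding tame_primes_def Spec_def by blast
  interpret product_ring_factor S R k
    using cring k(1) by (rule product_ring_factor.intro)
  \<comment> \<open>As \<open>Q\<close> is proper, the idempotent at \<open>k\<close> lies outside
    \<open>P\<close> and hence outside \<open>M\<close>; the dichotomy then leaves only its
    complement.\<close>
  have "\<one>\<^bsub>R k\<^esub> \<notin> Q"
    using primeideal.axioms(1)[OF k(2)] primeideal.I_notcarr[OF k(2)] ideal.one_imp_carrier by blast
  then have "single S R k \<one>\<^bsub>R k\<^esub> \<notin> M"
    using P(2) k(3) single_mem_preimage_iff factor.one_closed by blast
  then show thesis
    using max_regular_dichotomy[OF max] k(1) that by blast
qed

theorem theorem3p6:
  fixes S :: "'i set" and R :: "'i \<Rightarrow> ('a, 'm) ring_scheme"
  assumes "\<And>i. i \<in> S \<Longrightarrow> cring (R i)"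
    and "\<And>i. i \<in> S \<Longrightarrow> carrier (R i) \<noteq> {\<zero>\<^bsub>R i\<^esub>}"
  shows "{M. tame_max_regular_ideal M S R} =
    {proj_preimage S R k M | k M. k \<in> S \<and> max_regular_ideal M (R k)}"
proof (intro Set.set_eqI iffI)
  fix M assume "M \<in> {M. tame_max_regular_ideal M S R}"
  then have M: "tame_max_regular_ideal M S R"
    by simp
  obtain k where k: "k \<in> S" "cosingle S R k \<in> M"
    using assms(1) M by (rule tame_max_regular_ideal_obtain_cosingle)
  interpret product_ring_factor S R k
    using assms(1) k(1) by (rule product_ring_factor.intro)
  have max: "max_regular_ideal M (product_ring S R)"
    using M by (simp add: tame_max_regular_ideal_def)
  then have "ideal M (product_ring S R)"
    unfolding max_regular_ideal_def prod.regular_ideal_iff by blast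
  \<comment> \<open>With the complementary idempotent in \<open>M\<close>, the ideal correspondence
    gives \<open>J\<close>, and \<open>max_regular_preimage_iff\<close> carries max-regularity down
    to it.\<close>
  then obtain J where "ideal J (R k)" "M = proj_preimage S R k J"
    using k(2) by (rule ideal_eq_preimage)
  then show "M \<in> {proj_preimage S R k M | k M. k \<in> S \<and> max_regular_ideal M (R k)}"
    using max max_regular_preimage_iff k(1) by blast
next
  fix N assume "N \<in> {proj_preimage S R k M | k M. k \<in> S \<and> max_regular_ideal M (R k)}"
  then obtain k M where k: "k \<in> S" "max_regular_ideal M (R k)" "N = proj_preimage S R k M"
    by blast
  interpret product_ring_factor S R k
    using assms(1) k(1) by (rule product_ring_factor.intro)
  show "N \<in> {M. tame_max_regular_ideal M S R}"
    using tame_max_regular_preimage[OF k(2)] k(3) by simp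
qed

end
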